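(* Let $f,g:\mathbb{R}^n\to\mathbb{R}\cup\{\infty\}$ be closed, proper, convex functions. Assume the primal problem (P) is feasible and the dual problem (D) is strongly infeasible. Let $d=-\Pi_{\overline{\mathrm{dom} f^*+\mathrm{dom} g^*}}(0)$. Then for any $\gamma>0$, \[ v=-\gamma d=\gamma\,\Pi_{\overline{\mathrm{dom} f^*+\mathrm{dom} g^*}}(0)\neq 0 \] is the infimal displacement vector of the Douglas--Rachford operator $T_\gamma$. Furthermore, $d$ is a primal improving direction of (P).
   Context: A convex function is closed if its epigraph is closed, and proper if it is finite somewhere. $\mathrm{dom} f=\{x: f(x)<\infty\}$; $f^*$ is the convex conjugate; $\Pi_C$ is the Euclidean projection onto a nonempty closed convex set $C$; $\mathrm{Prox}_h(z)=\arg\min_x\{h(x)+\tfrac12\|x-z\|^2\}$. The recession function of a closed proper convex $f$ is $\mathrm{rec} f(d)=\lim_{\alpha\to\infty}\frac{f(x+\alpha d)-f(x)}{\alpha}$ for any $x\in\mathrm{dom} f$ (independent of $x$). (P): minimize $f(x)+g(x)$ over $x\in\mathbb{R}^n$; it is feasible if $0\in\mathrm{dom} f-\mathrm{dom} g$. (D): maximize $-f^*(\nu)-g^*(-\nu)$ over $\nu\in\mathbb{R}^n$; it is strongly infeasible if $0\notin\overline{\mathrm{dom} f^*+\mathrm{dom} g^*}$. A primal improving direction is a $d\in\mathbb{R}^n$ with $\mathrm{rec} f(d)+\mathrm{rec} g(d)<0$. The Douglas--Rachford operator is $T_\gamma=\frac12 I+\frac12(2\mathrm{Prox}_{\gamma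 g}-I)(2\mathrm{Prox}_{\gamma f}-I)$ (composition of operators). It is firmly nonexpansive, and $\overline{\mathrm{range}(I-T_\gamma)}$ is closed and convex; the infimal displacement vector of $T_\gamma$ is $\Pi_{\overline{\mathrm{range}(I-T_\gamma)}}(0)$, where $\mathrm{range}(I-T_\gamma)=\{z-T_\gamma(z): z\in\mathbb{R}^n\}$. *)

theory Defs
  imports "HOL-Analysis.Analysis"
begin

text \<open>
  Functions into the reals extended by plus infinity are functions into \<^typ>\<open>ereal\<close> that never
  take the value \<open>-\<infinity>\<close>.
\<close>

definition effective_domain :: "('a \<Rightarrow> ereal) \<Rightarrow> 'a set" where
  "effective_domain f = {x. f x < \<infinity>}"

definition ereal_epigraph :: "('a \<Rightarrow> ereal) \<Rightarrow> ('a \<times> real) set" where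
  "ereal_epigraph f = {(x, t). f x \<le> ereal t}"

text \<open>
  The right-hand side is never \<open>\<infinity> - \<infinity>\<close> for functions avoiding \<open>-\<infinity>\<close>, and \<open>0 * \<infinity> = 0\<close>
  in \<^typ>\<open>ereal\<close>, so the cases \<open>u = 0\<close> and \<open>v = 0\<close> are harmless.
\<close>
definition ereal_convex :: "('a::real_vector \<Rightarrow> ereal) \<Rightarrow> bool" where
  "ereal_convex f \<longleftrightarrow>
     (\<forall>x y. \<forall>u\<ge>0. \<forall>v\<ge>0. u + v = 1 \<longrightarrow>
        f (u *\<^sub>R x + v *\<^sub>R y) \<le> ereal u * f x + ereal v * f y)"

definition closed_proper_convex :: "('a::euclidean_space \<Rightarrow> ereal) \<Rightarrow> bool" where
  "closed_proper_convex f \<longleftrightarrow>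
     (\<forall>x. f x \<noteq> -\<infinity>) \<and> closed (ereal_epigraph f) \<and> (\<exists>x. \<bar>f x\<bar> \<noteq> \<infinity>) \<and> ereal_convex f"

definition convex_conjugate :: "('a::euclidean_space \<Rightarrow> ereal) \<Rightarrow> 'a \<Rightarrow> ereal" where
  "convex_conjugate f \<nu> = (SUP x. ereal (\<nu> \<bullet> x) - f x)"

text \<open>The common limit of the difference quotients at all base points in the effective domain.\<close>
definition recession_function :: "('a::euclidean_space \<Rightarrow> ereal) \<Rightarrow> 'a \<Rightarrow> ereal" where
  "recession_function f d =
     (THE r. \<forall>x\<in>effective_domain f.
        ((\<lambda>\<alpha>. (f (x + \<alpha> *\<^sub>R d) - f x) / ereal \<alpha>) \<longlongrightarrow> r) at_top)"

text \<open>The minimizer exists and is unique whenever \<open>h\<close> is closed, proper and convex.\<close>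
definition prox :: "('a::euclidean_space \<Rightarrow> ereal) \<Rightarrow> 'a \<Rightarrow> 'a" where
  "prox h z = (ARG_MIN (\<lambda>x. h x + ereal ((norm (x - z))\<^sup>2 / 2)) x. True)"

definition reflected_prox :: "('a::euclidean_space \<Rightarrow> ereal) \<Rightarrow> 'a \<Rightarrow> 'a" where
  "reflected_prox h z = 2 *\<^sub>R prox h z - z"

definition douglas_rachford ::
  "real \<Rightarrow> ('a::euclidean_space \<Rightarrow> ereal) \<Rightarrow> ('a \<Rightarrow> ereal) \<Rightarrow> 'a \<Rightarrow> 'a" where
  "douglas_rachford \<gamma> f g z =
     (1/2) *\<^sub>R z +
     (1/2) *\<^sub>R (reflected_prox (\<lambda>x. ereal \<gamma> * g x) \<circ> reflected_prox (\<lambda>x. ereal \<gamma> * f x)) z"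

definition infimal_displacement_vector :: "('a::euclidean_space \<Rightarrow> 'a) \<Rightarrow> 'a" where
  "infimal_displacement_vector T = closest_point (closure (range (\<lambda>z. z - T z))) 0"

text \<open>The Minkowski difference is written out since \<open>-\<close> on sets is the set difference.\<close>
definition primal_feasible ::
  "('a::euclidean_space \<Rightarrow> ereal) \<Rightarrow> ('a \<Rightarrow> ereal) \<Rightarrow> bool" where
  "primal_feasible f g \<longleftrightarrow>
     0 \<in> {x - y | x y. x \<in> effective_domain f \<and> y \<in> effective_domain g}"

definition dual_domain_sum ::
  "('a::euclidean_space \<Rightarrow> ereal) \<Rightarrow> ('a \<Rightarrow> ereal) \<Rightarrow> 'a set" where
  "dual_domain_sum f g =
     {\<nu> + \<mu> | \<nu> \<mu>. \<nu> \<in> effective_domain (convex_conjugate f) \<and>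
                 \<mu> \<in> effective_domain (convex_conjugate g)}"

definition dual_strongly_infeasible ::
  "('a::euclidean_space \<Rightarrow> ereal) \<Rightarrow> ('a \<Rightarrow> ereal) \<Rightarrow> bool" where
  "dual_strongly_infeasible f g \<longleftrightarrow> 0 \<notin> closure (dual_domain_sum f g)"

definition primal_improving_direction ::
  "('a::euclidean_space \<Rightarrow> ereal) \<Rightarrow> ('a \<Rightarrow> ereal) \<Rightarrow> 'a \<Rightarrow> bool" where
  "primal_improving_direction f g d \<longleftrightarrow> recession_function f d + recession_function g d < 0"

end

theory Submission
  imports Defs
begin

text \<open>
  Write \<open>C\<close> for the sum of the domains of \<open>f\<^sup>*\<close> and \<open>g\<^sup>*\<close>, \<open>p\<close> for the projection of the
  origin onto the closure of \<open>C\<close>, and \<open>T\<close> for the Douglas--Rachford operator.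

  One half of the claim on \<open>T\<close> is algebra. The two proximal steps at \<open>z\<close> give points \<open>x\<close>, \<open>y\<close> and
  subgradients \<open>u\<close> of \<open>f\<close> at \<open>x\<close> and \<open>w\<close> of \<open>g\<close> at \<open>y\<close> with \<open>z - T z = x - y = \<gamma> (u + w)\<close>. Subgradients
  lie in the domain of the conjugate, so every displacement lies in \<open>\<gamma> C\<close>, and hence in the half-space
  of all \<open>s\<close> with \<open>\<gamma> p \<bullet> s \<ge> \<parallel>\<gamma> p\<parallel>\<^sup>2\<close>, whose point of least norm is \<open>\<gamma> p\<close>. What remains is
  that \<open>\<gamma> p\<close> is a limit of displacements (\<open>douglas_rachford_displacement_near_projection\<close>).

  For this, regularise: \<open>T\<close> is nonexpansive, so \<open>T / (1 + \<delta>)\<close> is a contraction and has a fixed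
  point \<open>z\<close>, at which the displacement is \<open>r = - \<delta> z\<close>. Here \<open>r\<close> stays bounded as \<open>\<delta> \<rightarrow> 0\<close>, and \<open>\<delta> u\<close>
  does too. Fix \<open>x\<^sub>0\<close> in both effective domains, which exists by primal feasibility, and \<open>p\<^sub>0 = u\<^sub>0 + w\<^sub>0\<close>
  in \<open>C\<close> close to \<open>p\<close>. The Fenchel inequality makes \<open>(u - u\<^sub>0) \<bullet> (x - x\<^sub>0)\<close> and
  \<open>(w - w\<^sub>0) \<bullet> (y - x\<^sub>0)\<close> bounded below by constants. Adding the two bounds, multiplying by \<open>\<delta>\<close> and
  substituting \<open>\<delta> x = - r - \<delta> \<gamma> u\<close> leaves
  \<open>\<parallel>r\<parallel>\<^sup>2 / \<gamma> \<le> p\<^sub>0 \<bullet> r + \<delta> \<gamma> (p\<^sub>0 \<bullet> u) + O(\<delta>)\<close>.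
  The middle term is harmless even though \<open>\<delta> u\<close> need not tend to \<open>0\<close>: the obtuse-angle inequality
  for \<open>p\<close> at \<open>u\<^sub>0 + w\<close> bounds \<open>p \<bullet> u\<close> above, and \<open>p\<^sub>0 - p\<close> is small.
  Since \<open>p \<bullet> r \<ge> \<gamma> \<parallel>p\<parallel>\<^sup>2\<close>, the squared distance \<open>\<parallel>r - \<gamma> p\<parallel>\<^sup>2\<close> is at most
  \<open>\<parallel>r\<parallel>\<^sup>2 - \<gamma> (p \<bullet> r)\<close>, which the displayed inequality makes as small as desired.

  For the improving direction, the recession function of \<open>f\<close> is the support function of the domain
  of \<open>f\<^sup>*\<close> (\<open>recession_function_eq_support\<close>). Thus the sum of the two recession functions at \<open>- p\<close> is
  the supremum of \<open>- p \<bullet> s\<close> over \<open>s\<close> in \<open>C\<close>, which is at most \<open>- \<parallel>p\<parallel>\<^sup>2 < 0\<close>.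
\<close>

section \<open>Affine minorants and subgradients\<close>

text \<open>The pairs \<open>(u, c)\<close> singled out here form the epigraph of the conjugate of \<open>f\<close>.\<close>
definition affine_minorant :: "('a::euclidean_space \<Rightarrow> ereal) \<Rightarrow> 'a \<Rightarrow> real \<Rightarrow> bool" where
  "affine_minorant f u c \<longleftrightarrow> (\<forall>y. ereal (u \<bullet> y - c) \<le> f y)"

text \<open>
  The value at the base point is carried along as a real number, so that the subgradient inequality
  has no \<^typ>\<open>ereal\<close> arithmetic on its left-hand side.
\<close>
definition subgradient_at :: "('a::euclidean_space \<Rightarrow> ereal) \<Rightarrow> 'a \<Rightarrow> real \<Rightarrow> 'a \<Rightarrow> bool" where
  "subgradient_at f x a u \<longleftrightarrow> f x = ereal a \<and> (\<forall>y. ereal (a + u \<bullet> (y - x)) \<le> f y)"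

lemma dom_conjugate_iff:
  "u \<in> effective_domain (convex_conjugate f) \<longleftrightarrow> (\<exists>c. affine_minorant f u c)"
proof -
  have shift: "ereal (u \<bullet> y) - f y \<le> ereal c \<longleftrightarrow> ereal (u \<bullet> y - c) \<le> f y" for c y
    by (cases "f y") (auto simp: algebra_simps)
  have "convex_conjugate f u \<le> ereal c \<longleftrightarrow> affine_minorant f u c" for c
    unfolding convex_conjugate_def affine_minorant_def SUP_le_iff using shift by simp
  moreover have "convex_conjugate f u < \<infinity> \<longleftrightarrow> (\<exists>c. convex_conjugate f u \<le> ereal c)"
    by (cases "convex_conjugate f u") auto
  ultimately show ?thesis
    by (simp add: effective_domain_def)
qed

lemma dual_domain_sum_iff:
  "s \<in> dual_domain_sum f g \<longleftrightarrow>
     (\<exists>u w b c. s = u + w \<and> affine_minorant f u b \<and> affine_minorant g w c)"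
  unfolding dual_domain_sum_def mem_Collect_eq dom_conjugate_iff by metis

lemma affine_minorant_of_subgradient:
  assumes "subgradient_at f x a u"
  shows "affine_minorant f u (u \<bullet> x - a)"
  using assms by (simp add: subgradient_at_def affine_minorant_def inner_diff_right algebra_simps)

lemma ereal_convex_bound:
  assumes "ereal_convex f" "f x \<le> ereal a" "f y \<le> ereal b" "0 \<le> s" "0 \<le> t" "s + t = 1"
  shows "f (s *\<^sub>R x + t *\<^sub>R y) \<le> ereal (s * a + t * b)"
proof -
  have "f (s *\<^sub>R x + t *\<^sub>R y) \<le> ereal s * f x + ereal t * f y"
    using assms unfolding ereal_convex_def by blast
  also have "\<dots> \<le> ereal s * ereal a + ereal t * ereal b"
    using assms by (intro add_mono ereal_mult_left_mono) auto
  finally show ?thesis by simp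
qed

lemma convex_epigraph:
  assumes "ereal_convex f"
  shows "convex (ereal_epigraph f)"
  using ereal_convex_bound[OF assms] by (auto simp: convex_def ereal_epigraph_def)

lemma dom_finite_value:
  assumes "closed_proper_convex f" "x \<in> effective_domain f"
  obtains a where "f x = ereal a"
  using assms by (cases "f x") (auto simp: closed_proper_convex_def effective_domain_def)

lemma effective_domain_nonempty:
  assumes "closed_proper_convex f"
  obtains x where "x \<in> effective_domain f"
proof -
  have "\<exists>x. \<bar>f x\<bar> \<noteq> \<infinity>"
    using assms unfolding closed_proper_convex_def by blast
  then obtain x where "\<bar>f x\<bar> \<noteq> \<infinity>" ..
  then have "x \<in> effective_domain f"
    by (cases "f x") (auto simp: effective_domain_def)
  then show ?thesis by (rule that)
qed

text \<open>
  A point just below the graph, over the effective domain, is separated from the closed convex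
  epigraph. Both points \<open>(x, a - 1)\<close> and \<open>(x, a)\<close> are over the same \<open>x\<close>, so the separating
  hyperplane cannot be vertical.
\<close>
lemma affine_minorant_exists:
  assumes "closed_proper_convex f"
  obtains u c where "affine_minorant f u c"
proof -
  obtain x where x: "x \<in> effective_domain f"
    using assms effective_domain_nonempty by blast
  obtain a where a: "f x = ereal a"
    using dom_finite_value[OF assms x] .
  have "convex (ereal_epigraph f)" "closed (ereal_epigraph f)" "(x, a - 1) \<notin> ereal_epigraph f"
    using assms a by (auto simp: closed_proper_convex_def convex_epigraph)
      (simp add: ereal_epigraph_def)
  then obtain n b where nb: "n \<bullet> (x, a - 1) < b" "\<And>q. q \<in> ereal_epigraph f \<Longrightarrow> n \<bullet> q > b"
    using separating_hyperplane_closed_point by metis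
  obtain v h where n: "n = (v, h)"
    by (cases n)
  have "n \<bullet> (x, a) > b"
    using a by (intro nb) (simp add: ereal_epigraph_def)
  then have h: "h > 0"
    using nb(1) by (simp add: n inner_prod_def algebra_simps)
  have "ereal ((- (1 / h)) *\<^sub>R v \<bullet> y - (- b / h)) \<le> f y" for y
  proof (cases "f y")
    case (real r)
    then have "v \<bullet> y + h * r > b"
      using nb(2)[of "(y, r)"] by (simp add: n ereal_epigraph_def)
    then show ?thesis
      using h real by (simp add: field_simps)
  qed (use assms in \<open>auto simp: closed_proper_convex_def\<close>)
  then show ?thesis
    using that unfolding affine_minorant_def by blast
qed

section \<open>The proximal operator\<close>

text \<open>
  The prox objective is minimized over the epigraph rather than over the space: there it becomes the
  continuous function \<open>\<Phi>\<close>. An affine minorant keeps its sublevel sets on the epigraph bounded,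
  because the quadratic term outgrows every affine function.
\<close>
lemma prox_minimizer_exists:
  assumes "closed_proper_convex f" "\<gamma> > 0"
  obtains x a where "f x = ereal a"
    "\<And>y b. f y \<le> ereal b \<Longrightarrow> \<gamma> * a + (norm (x - z))\<^sup>2 / 2 \<le> \<gamma> * b + (norm (y - z))\<^sup>2 / 2"
proof -
  obtain u c where uc: "affine_minorant f u c"
    using affine_minorant_exists[OF assms(1)] .
  obtain x\<^sub>0 where x0: "x\<^sub>0 \<in> effective_domain f"
    using effective_domain_nonempty[OF assms(1)] .
  obtain a\<^sub>0 where a0: "f x\<^sub>0 = ereal a\<^sub>0"
    using dom_finite_value[OF assms(1) x0] .
  define \<Phi> where "\<Phi> = (\<lambda>q::'a \<times> real. \<gamma> * snd q + (norm (fst q - z))\<^sup>2 / 2)"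
  define m where "m = \<Phi> (x\<^sub>0, a\<^sub>0)"
  have cont: "continuous_on S \<Phi>" for S
    unfolding \<Phi>_def by (intro continuous_intros) auto
  define K where "K = ereal_epigraph f \<inter> {q. \<Phi> q \<le> m}"
  define A where "A = m + \<gamma> * (c - u \<bullet> z)"
  define R where "R = sqrt (4 * (A + (\<gamma> * norm u)\<^sup>2))"
  have K_bounds: "norm (x - z) \<le> R \<and> u \<bullet> z - norm u * R - c \<le> t \<and> t \<le> m / \<gamma>"
    if "(x, t) \<in> K" for x t
  proof -
    define D where "D = norm (x - z)"
    have le: "\<gamma> * t + D\<^sup>2 / 2 \<le> m" and "f x \<le> ereal t"
      using that by (auto simp: K_def \<Phi>_def D_def ereal_epigraph_def)
    then have "ereal (u \<bullet> x - c) \<le> ereal t"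
      using uc order_trans unfolding affine_minorant_def by blast
    moreover have "- (norm u * D) \<le> u \<bullet> (x - z)"
      using Cauchy_Schwarz_ineq2[of u "x - z"] by (simp add: D_def)
    ultimately have t: "u \<bullet> z - norm u * D - c \<le> t"
      by (simp add: inner_diff_right)
    then have "\<gamma> * (u \<bullet> z - norm u * D - c) \<le> \<gamma> * t"
      using assms(2) by (intro mult_left_mono) auto
    then have "D\<^sup>2 / 2 \<le> A + (\<gamma> * norm u) * D"
      using le by (simp add: A_def algebra_simps)
    moreover have "0 \<le> (\<gamma> * norm u - D / 2)\<^sup>2"
      by simp
    then have "(\<gamma> * norm u) * D \<le> (\<gamma> * norm u)\<^sup>2 + D\<^sup>2 / 4"
      by (simp add: power2_eq_square algebra_simps)
    ultimately have "D\<^sup>2 \<le> 4 * (A + (\<gamma> * norm u)\<^sup>2)"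
      by simp
    then have DR: "D \<le> R"
      unfolding R_def by (rule real_le_rsqrt)
    then have "norm u * D \<le> norm u * R"
      by (intro mult_left_mono) auto
    moreover have "\<gamma> * t \<le> m"
      using le zero_le_power2[of D] by linarith
    ultimately show ?thesis
      using t DR assms(2) by (auto simp: D_def field_simps)
  qed
  have "compact K"
  proof -
    have "closed K"
      unfolding K_def using assms(1)
      by (intro closed_Int closed_Collect_le cont) (auto simp: closed_proper_convex_def)
    moreover have "K \<subseteq> cball z R \<times> {u \<bullet> z - norm u * R - c .. m / \<gamma>}"
      using K_bounds by (auto simp: dist_norm norm_minus_commute)
    then have "bounded K"
      by (rule bounded_subset[rotated]) (intro bounded_Times bounded_cball bounded_closed_interval)
    ultimately show ?thesis
      by (simp add: compact_eq_bounded_closed)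
  qed
  moreover have K0: "(x\<^sub>0, a\<^sub>0) \<in> K"
    using a0 by (simp add: K_def m_def ereal_epigraph_def)
  ultimately obtain q where q: "q \<in> K" "\<And>q'. q' \<in> K \<Longrightarrow> \<Phi> q \<le> \<Phi> q'"
    using continuous_attains_inf[OF _ _ cont] by (metis empty_iff)
  obtain x t where xt: "q = (x, t)"
    by (cases q)
  have ft: "f x \<le> ereal t"
    using q(1) by (simp add: xt K_def ereal_epigraph_def)
  then have "x \<in> effective_domain f"
    by (cases "f x") (auto simp: effective_domain_def)
  then obtain a where a: "f x = ereal a"
    using dom_finite_value[OF assms(1)] by blast
  have min: "\<Phi> (x, a) \<le> \<Phi> (y, b)" if "f y \<le> ereal b" for y b
  proof -
    have "\<Phi> (x, a) \<le> \<Phi> q"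
      using ft a assms(2) by (simp add: xt \<Phi>_def)
    also have "\<Phi> q \<le> \<Phi> (y, b)"
    proof (cases "\<Phi> (y, b) \<le> m")
      case True
      then show ?thesis
        using that by (intro q(2)) (simp add: K_def ereal_epigraph_def)
    next
      case False
      then show ?thesis
        using q(2)[OF K0] by (simp add: m_def)
    qed
    finally show ?thesis .
  qed
  show ?thesis
    by (rule that[OF a]) (use min in \<open>simp add: \<Phi>_def\<close>)
qed

text \<open>
  The optimality condition of the proximal problem. Comparing the minimizer \<open>x\<close> with
  \<open>(1 - t) x + t y\<close> gives the subgradient inequality up to a term of order \<open>t\<close>, which vanishes as
  \<open>t\<close> tends to \<open>0\<close>. All further properties of the proximal operator are consequences of this lemma.
\<close>
lemma prox_subgradient:
  assumes f: "closed_proper_convex f" and \<gamma>: "\<gamma> > 0"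
    and x: "x = prox (\<lambda>x. ereal \<gamma> * f x) z"
  obtains a where "subgradient_at f x a ((1 / \<gamma>) *\<^sub>R (z - x))"
proof -
  define h where "h = (\<lambda>x. ereal \<gamma> * f x + ereal ((norm (x - z))\<^sup>2 / 2))"
  obtain x\<^sub>1 a\<^sub>1 where x1: "f x\<^sub>1 = ereal a\<^sub>1"
    "\<And>y b. f y \<le> ereal b \<Longrightarrow> \<gamma> * a\<^sub>1 + (norm (x\<^sub>1 - z))\<^sup>2 / 2 \<le> \<gamma> * b + (norm (y - z))\<^sup>2 / 2"
    using prox_minimizer_exists[OF f \<gamma>, of z] by blast
  have fin: "f y \<noteq> - \<infinity>" for y
    using f by (auto simp: closed_proper_convex_def)
  have "h x\<^sub>1 \<le> h y" for y
    using x1(2)[of y] fin[of y] \<gamma> by (cases "f y") (auto simp: h_def x1(1))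
  then have "is_arg_min h (\<lambda>_. True) x\<^sub>1"
    by (auto simp: is_arg_min_def not_less)
  then have "is_arg_min h (\<lambda>_. True) x"
    unfolding x prox_def arg_min_def h_def by (rule someI)
  then have min: "h x \<le> h y" for y
    by (auto simp: is_arg_min_def not_less)
  obtain a where a: "f x = ereal a"
    using min[of x\<^sub>1] fin[of x] \<gamma> by (cases "f x") (auto simp: h_def x1(1))
  have real_min: "\<gamma> * a + (norm (x - z))\<^sup>2 / 2 \<le> \<gamma> * b + (norm (y - z))\<^sup>2 / 2"
    if "f y \<le> ereal b" for y b
  proof -
    have "h y \<le> ereal \<gamma> * ereal b + ereal ((norm (y - z))\<^sup>2 / 2)"
      unfolding h_def using that \<gamma> by (intro add_mono ereal_mult_left_mono) auto
    then have "h x \<le> ereal (\<gamma> * b + (norm (y - z))\<^sup>2 / 2)"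
      using min[of y] by simp
    then show ?thesis
      by (simp add: h_def a)
  qed
  have "(z - x) \<bullet> (y - x) \<le> \<gamma> * (b - a)" if b: "f y = ereal b" for y b
  proof -
    have "(z - x) \<bullet> (y - x) \<le> \<gamma> * (b - a) + t * ((norm (y - x))\<^sup>2 / 2)" if t: "0 < t" "t \<le> 1" for t
    proof -
      have "f ((1 - t) *\<^sub>R x + t *\<^sub>R y) \<le> ereal ((1 - t) * a + t * b)"
        using f t a b by (intro ereal_convex_bound) (auto simp: closed_proper_convex_def)
      then have "\<gamma> * a + (norm (x - z))\<^sup>2 / 2
          \<le> \<gamma> * ((1 - t) * a + t * b) + (norm ((1 - t) *\<^sub>R x + t *\<^sub>R y - z))\<^sup>2 / 2"
        by (rule real_min)
      moreover have "(1 - t) *\<^sub>R x + t *\<^sub>R y - z = (x - z) + t *\<^sub>R (y - x)"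
        by (simp add: algebra_simps)
      moreover have "(norm ((x - z) + t *\<^sub>R (y - x)))\<^sup>2
          = (norm (x - z))\<^sup>2 + 2 * t * ((x - z) \<bullet> (y - x)) + t\<^sup>2 * (norm (y - x))\<^sup>2"
        unfolding power2_norm_eq_inner
        by (simp add: inner_add_left inner_add_right inner_commute power2_eq_square algebra_simps)
      ultimately have "0 \<le> \<gamma> * (t * (b - a)) + t * ((x - z) \<bullet> (y - x)) + t\<^sup>2 * (norm (y - x))\<^sup>2 / 2"
        by (simp add: algebra_simps)
      then have "0 \<le> t * (\<gamma> * (b - a) - (z - x) \<bullet> (y - x) + t * ((norm (y - x))\<^sup>2 / 2))"
        by (simp add: inner_diff_left power2_eq_square algebra_simps)
      then show ?thesis
        using t by (simp add: zero_le_mult_iff)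
    qed
    then have ev: "\<forall>\<^sub>F t in at_right 0. (z - x) \<bullet> (y - x) \<le> \<gamma> * (b - a) + t * ((norm (y - x))\<^sup>2 / 2)"
      unfolding eventually_at_right_field by (intro exI[of _ 1]) auto
    have "((\<lambda>t. \<gamma> * (b - a) + t * ((norm (y - x))\<^sup>2 / 2)) \<longlongrightarrow>
        \<gamma> * (b - a) + 0 * ((norm (y - x))\<^sup>2 / 2)) (at_right 0)"
      by (intro tendsto_intros)
    from tendsto_lowerbound[OF this ev] show ?thesis
      by simp
  qed
  then have "ereal (a + (1 / \<gamma>) * ((z - x) \<bullet> (y - x))) \<le> f y" for y
    using fin[of y] \<gamma> by (cases "f y") (auto simp: field_simps)
  then have "ereal (a + ((1 / \<gamma>) *\<^sub>R (z - x)) \<bullet> (y - x)) \<le> f y" for y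
    by simp
  then show ?thesis
    using a that unfolding subgradient_at_def by blast
qed

lemma subgradient_monotone:
  assumes "subgradient_at f x a u" "subgradient_at f y b v"
  shows "0 \<le> (u - v) \<bullet> (x - y)"
proof -
  have "a + u \<bullet> (y - x) \<le> b" "b + v \<bullet> (x - y) \<le> a"
    using assms unfolding subgradient_at_def by (metis ereal_less_eq(3))+
  then show ?thesis
    by (simp add: inner_diff_left inner_diff_right)
qed

text \<open>
  A substitute for monotonicity when \<open>u\<^sub>0\<close> is only in the domain of the conjugate and not a
  subgradient at \<open>x\<^sub>0\<close>: the Fenchel inequality replaces one of the subgradient inequalities. What
  matters is that the lower bound does not depend on \<open>x\<close> and \<open>u\<close>.
\<close>
lemma subgradient_monotone_up_to_constant:
  assumes "f x\<^sub>0 = ereal a\<^sub>0" "affine_minorant f u\<^sub>0 c\<^sub>0" "subgradient_at f x a u"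
  shows "u\<^sub>0 \<bullet> x\<^sub>0 - c\<^sub>0 - a\<^sub>0 \<le> (u - u\<^sub>0) \<bullet> (x - x\<^sub>0)"
proof -
  have "a + u \<bullet> (x\<^sub>0 - x) \<le> a\<^sub>0" "u\<^sub>0 \<bullet> x - c\<^sub>0 \<le> a"
    using assms unfolding subgradient_at_def affine_minorant_def by (metis ereal_less_eq(3))+
  then show ?thesis
    by (simp add: inner_diff_left inner_diff_right)
qed

lemma prox_firmly_nonexpansive:
  assumes f: "closed_proper_convex f" and \<gamma>: "\<gamma> > 0"
    and x: "x = prox (\<lambda>x. ereal \<gamma> * f x) z" and y: "y = prox (\<lambda>x. ereal \<gamma> * f x) w"
  shows "(norm (x - y))\<^sup>2 \<le> (x - y) \<bullet> (z - w)"
proof -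
  obtain a where a: "subgradient_at f x a ((1 / \<gamma>) *\<^sub>R (z - x))"
    using prox_subgradient[OF f \<gamma> x] .
  obtain b where b: "subgradient_at f y b ((1 / \<gamma>) *\<^sub>R (w - y))"
    using prox_subgradient[OF f \<gamma> y] .
  from subgradient_monotone[OF a b]
  have "0 \<le> (1 / \<gamma>) * (((z - x) - (w - y)) \<bullet> (x - y))"
    by (simp add: inner_diff_left inner_diff_right algebra_simps)
  then have "0 \<le> ((z - x) - (w - y)) \<bullet> (x - y)"
    using \<gamma> by (simp add: zero_le_divide_iff)
  then show ?thesis
    by (simp add: power2_norm_eq_inner inner_diff_left inner_diff_right inner_commute)
qed

lemma prox_nonexpansive:
  assumes "closed_proper_convex f" "\<gamma> > 0"
  shows "norm (prox (\<lambda>x. ereal \<gamma> * f x) z - prox (\<lambda>x. ereal \<gamma> * f x) w) \<le> norm (z - w)"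
    (is "norm ?D \<le> _")
proof -
  have "norm ?D * norm ?D \<le> ?D \<bullet> (z - w)"
    using prox_firmly_nonexpansive[OF assms refl refl, of z w] by (simp add: power2_eq_square)
  also have "\<dots> \<le> norm ?D * norm (z - w)"
    by (rule norm_cauchy_schwarz)
  finally show ?thesis
    by (cases "norm ?D = 0") (auto simp: mult_le_cancel_left)
qed

text \<open>
  Expanding the square of \<open>2 D - e\<close>, with \<open>D\<close> and \<open>e\<close> the differences of the images and of the
  arguments, turns firm nonexpansiveness of the proximal operator into this bound.
\<close>
lemma reflected_prox_nonexpansive:
  assumes "closed_proper_convex f" "\<gamma> > 0"
  shows "norm (reflected_prox (\<lambda>x. ereal \<gamma> * f x) z - reflected_prox (\<lambda>x. ereal \<gamma> * f x) w)
    \<le> norm (z - w)"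
proof -
  define D where "D = prox (\<lambda>x. ereal \<gamma> * f x) z - prox (\<lambda>x. ereal \<gamma> * f x) w"
  have "(norm D)\<^sup>2 \<le> D \<bullet> (z - w)"
    unfolding D_def by (rule prox_firmly_nonexpansive[OF assms refl refl])
  moreover have "(norm (2 *\<^sub>R D - e))\<^sup>2 = 4 * (norm D)\<^sup>2 - 4 * (D \<bullet> e) + (norm e)\<^sup>2" for e
    unfolding power2_norm_eq_inner
    by (simp add: inner_diff_left inner_diff_right inner_commute[of e D])
  ultimately have "(norm (2 *\<^sub>R D - (z - w)))\<^sup>2 \<le> (norm (z - w))\<^sup>2"
    by simp
  then have "norm (2 *\<^sub>R D - (z - w)) \<le> norm (z - w)"
    by (rule power2_le_imp_le) simp
  then show ?thesis
    by (simp add: reflected_prox_def D_def algebra_simps)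
qed

section \<open>The Douglas--Rachford operator\<close>

lemma douglas_rachford_nonexpansive:
  assumes "closed_proper_convex f" "closed_proper_convex g" "\<gamma> > 0"
  shows "norm (douglas_rachford \<gamma> f g z - douglas_rachford \<gamma> f g w) \<le> norm (z - w)"
proof -
  let ?R = "\<lambda>z. reflected_prox (\<lambda>x. ereal \<gamma> * g x) (reflected_prox (\<lambda>x. ereal \<gamma> * f x) z)"
  have "norm (?R z - ?R w) \<le> norm (z - w)"
    using reflected_prox_nonexpansive[OF assms(2,3)] reflected_prox_nonexpansive[OF assms(1,3)]
    by (rule order_trans)
  moreover have "douglas_rachford \<gamma> f g z - douglas_rachford \<gamma> f g w
      = (1/2) *\<^sub>R (z - w) + (1/2) *\<^sub>R (?R z - ?R w)"
    by (simp add: douglas_rachford_def algebra_simps)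
  ultimately show ?thesis
    using norm_triangle_ineq[of "(1/2) *\<^sub>R (z - w)" "(1/2) *\<^sub>R (?R z - ?R w)"] by simp
qed

lemma douglas_rachford_displacement:
  assumes "closed_proper_convex f" "closed_proper_convex g" "\<gamma> > 0"
  obtains x y u w a b where "x = prox (\<lambda>x. ereal \<gamma> * f x) z"
    "z = x + \<gamma> *\<^sub>R u" "z - douglas_rachford \<gamma> f g z = x - y" "x - y = \<gamma> *\<^sub>R (u + w)"
    "subgradient_at f x a u" "subgradient_at g y b w"
proof -
  define x where "x = prox (\<lambda>x. ereal \<gamma> * f x) z"
  define y where "y = prox (\<lambda>x. ereal \<gamma> * g x) (2 *\<^sub>R x - z)"
  obtain a where "subgradient_at f x a ((1 / \<gamma>) *\<^sub>R (z - x))"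
    using prox_subgradient[OF assms(1,3) x_def] .
  moreover obtain b where "subgradient_at g y b ((1 / \<gamma>) *\<^sub>R (2 *\<^sub>R x - z - y))"
    using prox_subgradient[OF assms(2,3) y_def] .
  moreover have "z - douglas_rachford \<gamma> f g z = x - y"
    unfolding douglas_rachford_def comp_apply reflected_prox_def x_def[symmetric] y_def[symmetric]
    by (simp add: scaleR_right_diff_distrib scaleR_2) (simp add: algebra_simps flip: scaleR_left_distrib)
  moreover have "x - y = \<gamma> *\<^sub>R ((1 / \<gamma>) *\<^sub>R (z - x) + (1 / \<gamma>) *\<^sub>R (2 *\<^sub>R x - z - y))"
    using assms(3) by (simp add: scaleR_right_distrib[symmetric] scaleR_2)
  moreover have "z = x + \<gamma> *\<^sub>R ((1 / \<gamma>) *\<^sub>R (z - x))"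
    using assms(3) by simp
  ultimately show ?thesis
    using that x_def by blast
qed

section \<open>The recession function as a support function\<close>

text \<open>
  The nontrivial half of the Fenchel--Moreau theorem. Let \<open>\<xi>\<close> be the proximal point of \<open>x\<close> with
  parameter \<open>1 / (k + 1)\<close>. The affine minorant touching \<open>f\<close> at \<open>\<xi>\<close> has slope \<open>(k + 1) (x - \<xi>)\<close>, so its
  value at \<open>x\<close> is \<open>f \<xi> + (k + 1) \<parallel>x - \<xi>\<parallel>\<^sup>2\<close>. As this is at most \<open>M\<close>, the points \<open>\<xi>\<close> converge to
  \<open>x\<close> with \<open>f \<xi> \<le> M\<close>, and closedness of the epigraph concludes. Working with proximal points avoids
  the vertical hyperplanes that arise when \<open>(x, M)\<close> is separated from the epigraph.
\<close>
lemma le_of_affine_minorants_le: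
  assumes f: "closed_proper_convex f"
    and M: "\<And>u c. affine_minorant f u c \<Longrightarrow> u \<bullet> x - c \<le> M"
  shows "f x \<le> ereal M"
proof -
  obtain u\<^sub>0 c\<^sub>0 where u0: "affine_minorant f u\<^sub>0 c\<^sub>0"
    using affine_minorant_exists[OF f] .
  define \<xi> where "\<xi> = (\<lambda>k. prox (\<lambda>y. ereal (1 / real (Suc k)) * f y) x)"
  define A where "A = M + c\<^sub>0 - u\<^sub>0 \<bullet> x + (norm u\<^sub>0)\<^sup>2"
  have \<xi>: "f (\<xi> k) \<le> ereal M \<and> (norm (x - \<xi> k))\<^sup>2 \<le> (A * 2) * inverse (real (Suc k))" for k
  proof -
    obtain a where a: "subgradient_at f (\<xi> k) a ((1 / (1 / real (Suc k))) *\<^sub>R (x - \<xi> k))"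
      by (rule prox_subgradient[OF f, of "1 / real (Suc k)" "\<xi> k" x]) (simp_all add: \<xi>_def)
    define D where "D = norm (x - \<xi> k)"
    from M[OF affine_minorant_of_subgradient[OF a]]
    have le: "a + real (Suc k) * D\<^sup>2 \<le> M"
      by (simp add: D_def power2_norm_eq_inner inner_diff_left inner_diff_right algebra_simps)
    have fa: "f (\<xi> k) = ereal a"
      using a by (simp add: subgradient_at_def)
    then have "u\<^sub>0 \<bullet> \<xi> k - c\<^sub>0 \<le> a"
      using u0 unfolding affine_minorant_def by (metis ereal_less_eq(3))
    moreover have "u\<^sub>0 \<bullet> (x - \<xi> k) \<le> norm u\<^sub>0 * D"
      unfolding D_def by (rule norm_cauchy_schwarz)
    moreover have "0 \<le> (norm u\<^sub>0 - D / 2)\<^sup>2"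
      by simp
    then have "norm u\<^sub>0 * D \<le> (norm u\<^sub>0)\<^sup>2 + D\<^sup>2 / 4"
      by (simp add: power2_eq_square algebra_simps)
    ultimately have "real (Suc k) * D\<^sup>2 \<le> A + D\<^sup>2 / 4"
      using le by (simp add: A_def inner_diff_right)
    moreover have "0 \<le> real k * D\<^sup>2" "0 \<le> D\<^sup>2"
      by simp_all
    ultimately have "real (Suc k) * D\<^sup>2 \<le> A * 2"
      unfolding of_nat_Suc distrib_right by linarith
    then have "D\<^sup>2 \<le> (A * 2) * inverse (real (Suc k))"
      by (simp add: field_simps)
    moreover have "a \<le> M"
      using le mult_nonneg_nonneg[OF of_nat_0_le_iff[of "Suc k"] zero_le_power2[of D]] by linarith
    ultimately show ?thesis
      by (simp add: fa D_def)
  qed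
  have "(\<lambda>k. (A * 2) * inverse (real (Suc k))) \<longlonglongrightarrow> (A * 2) * 0"
    by (intro tendsto_intros LIMSEQ_inverse_real_of_nat)
  then have bound: "(\<lambda>k. (A * 2) * inverse (real (Suc k))) \<longlonglongrightarrow> 0"
    by (simp only: mult_zero_right)
  have "(\<lambda>k. (norm (x - \<xi> k))\<^sup>2) \<longlonglongrightarrow> 0"
    by (rule tendsto_sandwich[OF _ _ tendsto_const bound])
      (use \<xi> in \<open>simp_all add: eventually_sequentially del: of_nat_Suc\<close>)
  then have "(\<lambda>k. sqrt ((norm (x - \<xi> k))\<^sup>2)) \<longlonglongrightarrow> sqrt 0"
    by (rule tendsto_real_sqrt)
  then have "(\<lambda>k. norm (\<xi> k - x)) \<longlonglongrightarrow> 0"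
    by (simp only: real_sqrt_abs abs_norm_cancel real_sqrt_zero norm_minus_commute[of x])
  then have "\<xi> \<longlonglongrightarrow> x"
    by (simp add: tendsto_norm_zero_iff LIM_zero_iff)
  then have "(\<lambda>k. (\<xi> k, M)) \<longlonglongrightarrow> (x, M)"
    by (intro tendsto_intros)
  moreover have "(\<xi> k, M) \<in> ereal_epigraph f" for k
    using \<xi>[of k] by (simp add: ereal_epigraph_def)
  moreover have "closed (ereal_epigraph f)"
    using f by (simp add: closed_proper_convex_def)
  ultimately have "(x, M) \<in> ereal_epigraph f"
    by (metis closed_sequentially)
  then show ?thesis
    by (simp add: ereal_epigraph_def)
qed

text \<open>
  Every difference quotient in direction \<open>d\<close> is at most the support function, because each affine
  minorant grows along \<open>d\<close> at most at that rate and \<open>f\<close> is the supremum of its affine minorants.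
  Conversely a minorant of slope \<open>u\<close> forces the quotients to be eventually at least \<open>u \<bullet> d\<close> up to an
  error that vanishes like \<open>1 / \<alpha>\<close>. So the quotients converge to the same limit from every base point.
\<close>
lemma recession_function_eq_support:
  assumes f: "closed_proper_convex f"
  shows "recession_function f d
    = (SUP u\<in>effective_domain (convex_conjugate f). ereal (u \<bullet> d))" (is "_ = ?\<sigma>")
proof -
  obtain u\<^sub>0 c\<^sub>0 where "affine_minorant f u\<^sub>0 c\<^sub>0"
    using affine_minorant_exists[OF f] .
  then have "u\<^sub>0 \<in> effective_domain (convex_conjugate f)"
    using dom_conjugate_iff by blast
  then have \<sigma>0: "ereal (u\<^sub>0 \<bullet> d) \<le> ?\<sigma>"
    by (rule SUP_upper)
  have lim: "((\<lambda>\<alpha>. (f (x + \<alpha> *\<^sub>R d) - f x) / ereal \<alpha>) \<longlongrightarrow> ?\<sigma>) at_top"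
    if x: "x \<in> effective_domain f" for x
  proof -
    obtain a where a: "f x = ereal a"
      using dom_finite_value[OF f x] .
    have upper: "(f (x + \<alpha> *\<^sub>R d) - f x) / ereal \<alpha> \<le> ?\<sigma>" if "\<alpha> > 0" for \<alpha>
    proof (cases ?\<sigma>)
      case (real s)
      have "u \<bullet> (x + \<alpha> *\<^sub>R d) - c \<le> a + \<alpha> * s" if uc: "affine_minorant f u c" for u c
      proof -
        have "ereal (u \<bullet> d) \<le> ?\<sigma>"
          using uc dom_conjugate_iff by (intro SUP_upper) blast
        then have "\<alpha> * (u \<bullet> d) \<le> \<alpha> * s"
          using \<open>\<alpha> > 0\<close> by (simp add: real)
        moreover have "u \<bullet> x - c \<le> a"
          using uc a unfolding affine_minorant_def by (metis ereal_less_eq(3))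
        ultimately show ?thesis
          by (simp add: inner_add_right)
      qed
      then have "f (x + \<alpha> *\<^sub>R d) \<le> ereal (a + \<alpha> * s)"
        by (rule le_of_affine_minorants_le[OF f])
      then show ?thesis
        using \<open>\<alpha> > 0\<close> a f unfolding real
        by (cases "f (x + \<alpha> *\<^sub>R d)") (auto simp: closed_proper_convex_def field_simps)
    qed (use \<sigma>0 in auto)
    show ?thesis
    proof (rule order_tendstoI)
      fix s assume "?\<sigma> < s"
      show "\<forall>\<^sub>F \<alpha> in at_top. (f (x + \<alpha> *\<^sub>R d) - f x) / ereal \<alpha> < s"
        using eventually_gt_at_top[of 0]
        by eventually_elim (use upper \<open>?\<sigma> < s\<close> in \<open>auto intro: le_less_trans\<close>)
    next
      fix s assume "s < ?\<sigma>"
      then obtain u c where "s < ereal (u \<bullet> d)" and uc: "affine_minorant f u c"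
        using dom_conjugate_iff by (metis less_SUP_iff)
      have "((\<lambda>\<alpha>. u \<bullet> d + (u \<bullet> x - c - a) / \<alpha>) \<longlongrightarrow> u \<bullet> d + 0) at_top"
        by (intro tendsto_intros tendsto_divide_0[OF tendsto_const]
            filterlim_at_top_imp_at_infinity filterlim_ident)
      then have "((\<lambda>\<alpha>. ereal (u \<bullet> d + (u \<bullet> x - c - a) / \<alpha>)) \<longlongrightarrow> ereal (u \<bullet> d)) at_top"
        by simp
      then have "\<forall>\<^sub>F \<alpha> in at_top. s < ereal (u \<bullet> d + (u \<bullet> x - c - a) / \<alpha>)"
        using \<open>s < ereal (u \<bullet> d)\<close> by (rule order_tendstoD)
      then show "\<forall>\<^sub>F \<alpha> in at_top. s < (f (x + \<alpha> *\<^sub>R d) - f x) / ereal \<alpha>"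
        using eventually_gt_at_top[of 0]
      proof eventually_elim
        case (elim \<alpha>)
        have "ereal (u \<bullet> (x + \<alpha> *\<^sub>R d) - c) \<le> f (x + \<alpha> *\<^sub>R d)"
          using uc by (simp add: affine_minorant_def)
        moreover have "u \<bullet> d + (u \<bullet> x - c - a) / \<alpha> = (u \<bullet> (x + \<alpha> *\<^sub>R d) - c - a) / \<alpha>"
          using elim(2) by (simp add: inner_add_right field_simps)
        ultimately have "ereal (u \<bullet> d + (u \<bullet> x - c - a) / \<alpha>)
            \<le> (f (x + \<alpha> *\<^sub>R d) - f x) / ereal \<alpha>"
          using elim(2) a by (cases "f (x + \<alpha> *\<^sub>R d)") (auto intro: divide_right_mono)
        with elim(1) show ?case
          by (rule less_le_trans)
      qed
    qed
  qed
  obtain x where x: "x \<in> effective_domain f"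
    using effective_domain_nonempty[OF f] .
  show ?thesis
    unfolding recession_function_def
    using lim x by (intro the_equality ballI) (auto intro: tendsto_unique[OF trivial_limit_at_top_linorder])
qed


section \<open>Displacements close to the projection\<close>

text \<open>
  The fixed point of the contraction \<open>T / (1 + \<delta>)\<close>. Its displacement \<open>z - T z = - \<delta> z\<close> is bounded
  independently of \<open>\<delta>\<close>.
\<close>
lemma nonexpansive_eigenvector:
  fixes T :: "'a::euclidean_space \<Rightarrow> 'a"
  assumes T: "\<And>z w. norm (T z - T w) \<le> norm (z - w)" and \<delta>: "\<delta> > 0"
  obtains z where "T z = (1 + \<delta>) *\<^sub>R z" "\<delta> * norm z \<le> norm (T 0)"
proof -
  have "\<exists>!z. (1 / (1 + \<delta>)) *\<^sub>R T z = z"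
  proof (rule banach_fix_type)
    show "\<forall>z w. dist ((1 / (1 + \<delta>)) *\<^sub>R T z) ((1 / (1 + \<delta>)) *\<^sub>R T w) \<le> (1 / (1 + \<delta>)) * dist z w"
      using T \<delta> by (auto simp: dist_norm scaleR_diff_right[symmetric] divide_right_mono)
  qed (use \<delta> in auto)
  then obtain z where z: "(1 / (1 + \<delta>)) *\<^sub>R T z = z"
    by blast
  have Tz: "T z = (1 + \<delta>) *\<^sub>R z"
    using \<delta> by (subst z[symmetric]) simp
  have "(1 + \<delta>) * norm z \<le> norm z + norm (T 0)"
    using norm_triangle_ineq[of "T z - T 0" "T 0"] T[of z 0] \<delta> by (simp add: Tz)
  then show ?thesis
    using that Tz by (simp add: algebra_simps)
qed

lemma convex_dual_domain_sum: "convex (dual_domain_sum f g)"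
proof -
  have "convex (effective_domain (convex_conjugate h))" for h :: "'a \<Rightarrow> ereal"
  proof (rule convexI)
    fix u v and s t :: real
    assume uv: "u \<in> effective_domain (convex_conjugate h)" "v \<in> effective_domain (convex_conjugate h)"
      and st: "0 \<le> s" "0 \<le> t" "s + t = 1"
    obtain b c where bc: "affine_minorant h u b" "affine_minorant h v c"
      using uv unfolding dom_conjugate_iff by blast
    have "ereal ((s *\<^sub>R u + t *\<^sub>R v) \<bullet> y - (s * b + t * c)) \<le> h y" for y
    proof (cases "h y")
      case (real r)
      then have "u \<bullet> y - b \<le> r" "v \<bullet> y - c \<le> r"
        using bc unfolding affine_minorant_def by (metis ereal_less_eq(3))+
      then have "s * (u \<bullet> y - b) + t * (v \<bullet> y - c) \<le> r"
        using st by (intro convex_bound_le) auto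
      then show ?thesis
        by (simp add: real inner_add_left algebra_simps)
    next
      case MInf
      have "ereal (u \<bullet> y - b) \<le> h y"
        using bc(1) by (simp add: affine_minorant_def)
      with MInf show ?thesis
        by simp
    qed simp
    then show "s *\<^sub>R u + t *\<^sub>R v \<in> effective_domain (convex_conjugate h)"
      unfolding dom_conjugate_iff affine_minorant_def by blast
  qed
  from convex_sums[OF this[of f] this[of g]] show ?thesis
    by (rule back_subst[of convex]) (auto simp: dual_domain_sum_def)
qed

lemma dual_domain_sum_nonempty:
  assumes "closed_proper_convex f" "closed_proper_convex g"
  shows "dual_domain_sum f g \<noteq> {}"
proof -
  obtain u b where "affine_minorant f u b"
    using affine_minorant_exists[OF assms(1)] .
  moreover obtain w c where "affine_minorant g w c"
    using affine_minorant_exists[OF assms(2)] .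
  ultimately show ?thesis
    using dual_domain_sum_iff[of "u + w" f g] by blast
qed

lemma closest_point_origin_obtuse:
  assumes "convex S" "s \<in> S"
  shows "(norm (closest_point (closure S) 0))\<^sup>2 \<le> closest_point (closure S) 0 \<bullet> s"
  using closest_point_dot[of "closure S" s 0] assms closure_subset[of S]
  by (auto simp: convex_closure inner_diff_right power2_norm_eq_inner)

text \<open>
  Any \<open>s\<close> in \<open>S\<close> satisfies \<open>\<parallel>s - q\<parallel>\<^sup>2 \<le> \<parallel>s\<parallel>\<^sup>2 - \<parallel>q\<parallel>\<^sup>2\<close>, so a point of \<open>S\<close> no longer than \<open>q\<close>
  coincides with \<open>q\<close>.
\<close>
lemma closest_point_origin_eqI:
  assumes "closed S" "q \<in> S" and q: "\<And>s. s \<in> S \<Longrightarrow> (norm q)\<^sup>2 \<le> q \<bullet> s"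
  shows "closest_point S 0 = q"
proof -
  define s where "s = closest_point S 0"
  have "s \<in> S"
    using assms closest_point_in_set unfolding s_def by blast
  have "norm s \<le> norm q"
    using closest_point_le[OF assms(1,2), of 0] by (simp add: s_def)
  then have "(norm s)\<^sup>2 \<le> (norm q)\<^sup>2"
    by (intro power_mono) auto
  moreover have "(norm (s - q))\<^sup>2 = (norm s)\<^sup>2 - 2 * (q \<bullet> s) + (norm q)\<^sup>2"
    unfolding power2_norm_eq_inner by (simp add: inner_diff_left inner_diff_right inner_commute)
  ultimately have "(norm (s - q))\<^sup>2 \<le> 0"
    using q[OF \<open>s \<in> S\<close>] by linarith
  then show ?thesis
    by (simp add: s_def)
qed

lemma douglas_rachford_displacement_in_dual_domain_sum:
  assumes "closed_proper_convex f" "closed_proper_convex g" "\<gamma> > 0"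
  obtains s where "s \<in> dual_domain_sum f g" "z - douglas_rachford \<gamma> f g z = \<gamma> *\<^sub>R s"
proof -
  obtain x y u w a b where "z - douglas_rachford \<gamma> f g z = x - y" "x - y = \<gamma> *\<^sub>R (u + w)"
    "subgradient_at f x a u" "subgradient_at g y b w"
    by (rule douglas_rachford_displacement[OF assms])
  then show ?thesis
    using that[of "u + w"] affine_minorant_of_subgradient dual_domain_sum_iff by metis
qed

text \<open>
  The order of choices matters. The bounds \<open>R\<close> on the displacement and \<open>B\<close> on \<open>\<delta> \<parallel>u\<parallel>\<close> are independent
  of everything chosen later, so \<open>p\<^sub>0\<close> can first be taken within \<open>\<eta>\<close> of \<open>p\<close>. The constant \<open>K\<close>
  depends on \<open>p\<^sub>0\<close> and its decomposition, and may blow up as \<open>p\<^sub>0\<close> approaches \<open>p\<close>; the parameter \<open>\<delta>\<close>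
  is chosen last, to absorb it. The final estimate is
  \<open>\<parallel>r - \<gamma> p\<parallel>\<^sup>2 \<le> A \<eta> + \<delta> K\<close> for the displacement \<open>r\<close>.
\<close>
lemma douglas_rachford_displacement_near_projection:
  fixes f g :: "'a::euclidean_space \<Rightarrow> ereal"
  assumes f: "closed_proper_convex f" and g: "closed_proper_convex g" and \<gamma>: "\<gamma> > 0"
    and x0: "x\<^sub>0 \<in> effective_domain f" "x\<^sub>0 \<in> effective_domain g"
    and p: "p = closest_point (closure (dual_domain_sum f g)) 0" and \<epsilon>: "\<epsilon> > 0"
  shows "\<exists>z. norm ((z - douglas_rachford \<gamma> f g z) - \<gamma> *\<^sub>R p) < \<epsilon>"
proof -
  define T where "T = douglas_rachford \<gamma> f g"
  define R where "R = norm (T 0)"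
  define P where "P = norm (prox (\<lambda>x. ereal \<gamma> * f x) 0)"
  define B where "B = (2 * R + P) / \<gamma>"
  define A where "A = \<gamma> * R + \<gamma>\<^sup>2 * B"
  define \<eta> where "\<eta> = \<epsilon>\<^sup>2 / 2 / (A + 1)"
  have nonneg: "R \<ge> 0" "P \<ge> 0" "B \<ge> 0" "A \<ge> 0"
    using \<gamma> by (auto simp: R_def P_def B_def A_def)
  then have \<eta>: "\<eta> > 0" "A * \<eta> < \<epsilon>\<^sup>2 / 2"
    using \<epsilon> by (auto simp: \<eta>_def field_simps add_nonneg_pos)
  have obtuse: "(norm p)\<^sup>2 \<le> p \<bullet> (u + w)" if "affine_minorant f u b" "affine_minorant g w c" for u w b c
    using that closest_point_origin_obtuse[OF convex_dual_domain_sum, of "u + w" f g]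
    unfolding p dual_domain_sum_iff by blast
  have "p \<in> closure (dual_domain_sum f g)"
    unfolding p using dual_domain_sum_nonempty[OF f g] by (intro closest_point_in_set) auto
  then obtain p\<^sub>0 where "p\<^sub>0 \<in> dual_domain_sum f g" and p0: "dist p\<^sub>0 p < \<eta>"
    using \<eta>(1) unfolding closure_approachable by blast
  then obtain u\<^sub>0 w\<^sub>0 b\<^sub>0 c\<^sub>0 where u0w0: "p\<^sub>0 = u\<^sub>0 + w\<^sub>0"
    "affine_minorant f u\<^sub>0 b\<^sub>0" "affine_minorant g w\<^sub>0 c\<^sub>0"
    using dual_domain_sum_iff by metis
  obtain \<phi> where \<phi>: "f x\<^sub>0 = ereal \<phi>"
    using dom_finite_value[OF f x0(1)] .
  obtain \<psi> where \<psi>: "g x\<^sub>0 = ereal \<psi>"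
    using dom_finite_value[OF g x0(2)] .
  define C where "C = (b\<^sub>0 + \<phi> - u\<^sub>0 \<bullet> x\<^sub>0) + (c\<^sub>0 + \<psi> - w\<^sub>0 \<bullet> x\<^sub>0)"
  define M where "M = norm p * R / \<gamma> - (norm p)\<^sup>2 + p \<bullet> u\<^sub>0"
  define K where "K = \<gamma>\<^sup>2 * M + \<gamma> * (C + (R / \<gamma> + norm p\<^sub>0) * norm x\<^sub>0 + norm w\<^sub>0 * R)"
  define \<delta> where "\<delta> = min 1 (\<epsilon>\<^sup>2 / 2 / (\<bar>K\<bar> + 1))"
  have \<delta>: "\<delta> > 0" "\<delta> \<le> 1"
    using \<epsilon> by (auto simp: \<delta>_def)
  have "\<delta> * K \<le> \<delta> * \<bar>K\<bar>"
    using \<delta> by (intro mult_left_mono) auto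
  also have "\<dots> \<le> (\<epsilon>\<^sup>2 / 2 / (\<bar>K\<bar> + 1)) * \<bar>K\<bar>"
    by (intro mult_right_mono) (auto simp: \<delta>_def)
  also have "\<dots> \<le> \<epsilon>\<^sup>2 / 2"
    by (simp add: field_simps)
  finally have \<delta>K: "\<delta> * K \<le> \<epsilon>\<^sup>2 / 2" .
  obtain z where z: "T z = (1 + \<delta>) *\<^sub>R z" "\<delta> * norm z \<le> R"
    using nonexpansive_eigenvector[of T \<delta>] douglas_rachford_nonexpansive[OF f g \<gamma>] \<delta>(1)
    unfolding T_def R_def by blast
  obtain x y u w a b where xy: "x = prox (\<lambda>x. ereal \<gamma> * f x) z" "z = x + \<gamma> *\<^sub>R u"
    "z - T z = x - y" "x - y = \<gamma> *\<^sub>R (u + w)"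
    and sub: "subgradient_at f x a u" "subgradient_at g y b w"
    unfolding T_def by (rule douglas_rachford_displacement[OF f g \<gamma>, of z])
  define s where "s = u + w"
  have w: "w = s - u" and y: "y = x - \<gamma> *\<^sub>R s"
    using xy(4) by (auto simp: s_def algebra_simps)
  have r: "z - T z = \<gamma> *\<^sub>R s"
    using xy by (simp add: s_def)
  have \<delta>z: "\<gamma> *\<^sub>R s = - \<delta> *\<^sub>R z"
    unfolding r[symmetric] z(1) by (simp add: algebra_simps)
  have s_bound: "\<gamma> * norm s \<le> R"
  proof -
    have "norm (\<gamma> *\<^sub>R s) = norm (- \<delta> *\<^sub>R z)"
      by (simp only: \<delta>z)
    then show ?thesis
      using z(2) \<gamma> \<delta>(1) by simp
  qed
  have u_bound: "\<delta> * norm u \<le> B"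
  proof -
    have "norm x \<le> norm z + P"
      using prox_nonexpansive[OF f \<gamma>, of z 0] norm_triangle_sub[of x "prox (\<lambda>x. ereal \<gamma> * f x) 0"]
      by (simp add: xy(1) P_def)
    moreover have "\<gamma> * norm u = norm (z - x)"
      using xy(2) \<gamma> by simp
    ultimately have "\<gamma> * norm u \<le> 2 * norm z + P"
      using norm_triangle_ineq4[of z x] by simp
    then have "\<delta> * (\<gamma> * norm u) \<le> \<delta> * (2 * norm z + P)"
      using \<delta>(1) by (intro mult_left_mono) auto
    also have "\<dots> \<le> 2 * R + P"
      using z(2) \<delta> mult_right_mono[of \<delta> 1 P] nonneg by (simp add: distrib_left)
    finally show ?thesis
      using \<gamma> by (simp add: B_def field_simps)
  qed
  \<comment> \<open>The two lower bounds are added. The substitutions \<open>w = s - u\<close> and \<open>y = x - \<gamma> s\<close> leave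
      only \<open>x\<close>, \<open>s\<close> and \<open>u\<close>; after multiplication by \<open>\<delta>\<close> the unbounded point \<open>x\<close> is replaced by the
      bounded \<open>\<delta> x = - \<gamma> s - \<delta> \<gamma> u\<close>, and the terms in \<open>u \<bullet> s\<close> cancel.\<close>
  have "- C \<le> (u - u\<^sub>0) \<bullet> (x - x\<^sub>0) + (w - w\<^sub>0) \<bullet> (y - x\<^sub>0)"
    using subgradient_monotone_up_to_constant[OF \<phi> u0w0(2) sub(1)]
      subgradient_monotone_up_to_constant[OF \<psi> u0w0(3) sub(2)] by (simp add: C_def)
  also have "\<dots> = (s - p\<^sub>0) \<bullet> (x - x\<^sub>0) - \<gamma> * (s \<bullet> s) + \<gamma> * (u \<bullet> s) + \<gamma> * (w\<^sub>0 \<bullet> s)"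
    unfolding w y u0w0(1) by (simp add: inner_diff_left inner_diff_right inner_add_left algebra_simps)
  finally have "\<delta> * (- C) \<le> \<delta> * \<dots>"
    using \<delta>(1) by (intro mult_left_mono) auto
  moreover have "\<delta> * (v \<bullet> x) = - \<gamma> * (v \<bullet> s) - \<delta> * \<gamma> * (v \<bullet> u)" for v
  proof -
    have "\<delta> *\<^sub>R x = - (\<gamma> *\<^sub>R s) - (\<delta> * \<gamma>) *\<^sub>R u"
      unfolding \<delta>z xy(2) by (simp add: algebra_simps)
    then have "v \<bullet> (\<delta> *\<^sub>R x) = v \<bullet> (- (\<gamma> *\<^sub>R s) - (\<delta> * \<gamma>) *\<^sub>R u)"
      by simp
    then show ?thesis
      by (simp add: inner_diff_right)
  qed
  from this[of s] this[of p\<^sub>0]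
  have "\<delta> * ((s - p\<^sub>0) \<bullet> x) = - \<gamma> * (s \<bullet> s) - \<delta> * \<gamma> * (u \<bullet> s)
      + \<gamma> * (p\<^sub>0 \<bullet> s) + \<delta> * \<gamma> * (p\<^sub>0 \<bullet> u)"
    by (simp add: inner_diff_left algebra_simps inner_commute)
  ultimately have "\<gamma> * (s \<bullet> s) + \<delta> * (\<gamma> * (s \<bullet> s)) \<le> \<gamma> * (p\<^sub>0 \<bullet> s) + \<delta> * \<gamma> * (p\<^sub>0 \<bullet> u)
      + \<delta> * (C - (s - p\<^sub>0) \<bullet> x\<^sub>0 + \<gamma> * (w\<^sub>0 \<bullet> s))"
    by (simp add: inner_diff_right distrib_left right_diff_distrib)
  moreover have "0 \<le> \<delta> * (\<gamma> * (s \<bullet> s))"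
    using \<delta>(1) \<gamma> by simp
  moreover have "\<delta> * (C - (s - p\<^sub>0) \<bullet> x\<^sub>0 + \<gamma> * (w\<^sub>0 \<bullet> s))
      \<le> \<delta> * (C + (R / \<gamma> + norm p\<^sub>0) * norm x\<^sub>0 + norm w\<^sub>0 * R)"
  proof (intro mult_left_mono add_mono)
    have "- ((s - p\<^sub>0) \<bullet> x\<^sub>0) \<le> norm (s - p\<^sub>0) * norm x\<^sub>0"
      using Cauchy_Schwarz_ineq2[of "s - p\<^sub>0" x\<^sub>0] by simp
    also have "\<dots> \<le> (R / \<gamma> + norm p\<^sub>0) * norm x\<^sub>0"
    proof (rule mult_right_mono)
      have "norm s \<le> R / \<gamma>"
        using s_bound \<gamma> by (simp add: field_simps)
      then show "norm (s - p\<^sub>0) \<le> R / \<gamma> + norm p\<^sub>0"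
        using norm_triangle_ineq4[of s p\<^sub>0] by linarith
    qed simp
    finally show "C - (s - p\<^sub>0) \<bullet> x\<^sub>0 \<le> C + (R / \<gamma> + norm p\<^sub>0) * norm x\<^sub>0"
      by simp
    have "\<gamma> * (w\<^sub>0 \<bullet> s) \<le> \<gamma> * (norm w\<^sub>0 * norm s)"
      using \<gamma> by (intro mult_left_mono norm_cauchy_schwarz) auto
    also have "\<dots> \<le> norm w\<^sub>0 * R"
      using mult_left_mono[OF s_bound, of "norm w\<^sub>0"] by (simp add: mult.left_commute)
    finally show "\<gamma> * (w\<^sub>0 \<bullet> s) \<le> norm w\<^sub>0 * R" .
  qed (use \<delta> in auto)
  ultimately have main: "\<gamma> * (s \<bullet> s) \<le> \<gamma> * (p\<^sub>0 \<bullet> s) + \<delta> * \<gamma> * (p\<^sub>0 \<bullet> u)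
      + \<delta> * (C + (R / \<gamma> + norm p\<^sub>0) * norm x\<^sub>0 + norm w\<^sub>0 * R)"
    by linarith
  \<comment> \<open>Although \<open>u\<close> may be of order \<open>1 / \<delta>\<close>, its component along \<open>p\<close> is bounded above: a large
      \<open>p \<bullet> u\<close> would, as \<open>u + w\<close> is bounded, make \<open>p \<bullet> (u\<^sub>0 + w)\<close> too small.\<close>
  have pu: "p \<bullet> u \<le> M"
  proof -
    have "(norm p)\<^sup>2 \<le> p \<bullet> (u\<^sub>0 + w)"
      using obtuse u0w0(2) affine_minorant_of_subgradient[OF sub(2)] by blast
    moreover have "p \<bullet> s \<le> norm p * (R / \<gamma>)"
      using s_bound \<gamma> by (intro order_trans[OF norm_cauchy_schwarz] mult_left_mono)
        (auto simp: field_simps)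
    ultimately show ?thesis
      by (simp add: M_def w inner_add_right inner_diff_right)
  qed
  have near: "\<gamma> * ((p\<^sub>0 - p) \<bullet> s) + \<delta> * \<gamma> * ((p\<^sub>0 - p) \<bullet> u) \<le> \<eta> * (R + \<gamma> * B)"
  proof -
    have pp: "norm (p\<^sub>0 - p) \<le> \<eta>"
      using p0 by (simp add: dist_norm)
    have "\<gamma> * ((p\<^sub>0 - p) \<bullet> s) \<le> \<gamma> * (\<eta> * norm s)"
      using \<gamma> pp by (intro mult_left_mono order_trans[OF norm_cauchy_schwarz] mult_right_mono) auto
    also have "\<dots> \<le> \<eta> * R"
      using mult_left_mono[OF s_bound, of \<eta>] \<eta>(1) by (simp add: mult.left_commute)
    finally have 1: "\<gamma> * ((p\<^sub>0 - p) \<bullet> s) \<le> \<eta> * R" .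
    have "\<delta> * \<gamma> * ((p\<^sub>0 - p) \<bullet> u) \<le> \<delta> * \<gamma> * (\<eta> * norm u)"
      using \<gamma> \<delta>(1) pp
      by (intro mult_left_mono order_trans[OF norm_cauchy_schwarz] mult_right_mono) auto
    also have "\<dots> = (\<eta> * \<gamma>) * (\<delta> * norm u)"
      by simp
    also have "\<dots> \<le> (\<eta> * \<gamma>) * B"
      using u_bound \<eta>(1) \<gamma> by (intro mult_left_mono) auto
    finally show ?thesis
      using 1 by (simp add: distrib_left)
  qed
  have "(norm (\<gamma> *\<^sub>R s - \<gamma> *\<^sub>R p))\<^sup>2 = \<gamma>\<^sup>2 * (s \<bullet> s - 2 * (p \<bullet> s) + (norm p)\<^sup>2)"
    unfolding power2_norm_eq_inner scaleR_diff_right[symmetric]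
    by (simp add: inner_diff_left inner_diff_right inner_commute power2_eq_square algebra_simps)
  also have "\<dots> \<le> \<gamma>\<^sup>2 * (s \<bullet> s - p \<bullet> s)"
    using obtuse[OF affine_minorant_of_subgradient[OF sub(1)] affine_minorant_of_subgradient[OF sub(2)]]
    by (intro mult_left_mono) (auto simp: s_def)
  also have "\<dots> = \<gamma> * (\<gamma> * (s \<bullet> s) - \<gamma> * (p \<bullet> s))"
    by (simp add: power2_eq_square algebra_simps)
  also have "\<dots> \<le> \<gamma> * (\<eta> * (R + \<gamma> * B) + \<delta> * \<gamma> * M
      + \<delta> * (C + (R / \<gamma> + norm p\<^sub>0) * norm x\<^sub>0 + norm w\<^sub>0 * R))"
  proof (rule mult_left_mono)
    have "\<delta> * \<gamma> * (p \<bullet> u) \<le> \<delta> * \<gamma> * M"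
      using pu \<delta>(1) \<gamma> by (intro mult_left_mono) auto
    then show "\<gamma> * (s \<bullet> s) - \<gamma> * (p \<bullet> s) \<le> \<eta> * (R + \<gamma> * B) + \<delta> * \<gamma> * M
      + \<delta> * (C + (R / \<gamma> + norm p\<^sub>0) * norm x\<^sub>0 + norm w\<^sub>0 * R)"
      using main near by (simp add: inner_diff_left right_diff_distrib)
  qed (use \<gamma> in simp)
  also have "\<dots> = A * \<eta> + \<delta> * K"
    by (simp add: A_def K_def power2_eq_square distrib_left distrib_right mult_ac)
  also have "\<dots> < \<epsilon>\<^sup>2"
    using \<eta>(2) \<delta>K by simp
  finally have "norm (\<gamma> *\<^sub>R s - \<gamma> *\<^sub>R p) < \<epsilon>"
    by (rule power2_less_imp_less) (use \<epsilon> in simp)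
  then show ?thesis
    using r unfolding T_def by metis
qed

section \<open>The infimal displacement vector and the improving direction\<close>

text \<open>
  The half-space of all \<open>s\<close> with \<open>\<parallel>\<gamma> p\<parallel>\<^sup>2 \<le> \<gamma> p \<bullet> s\<close> is closed, so it contains the closure of the
  range along with the range. As \<open>\<gamma> p\<close> is the only point of least norm in the half-space and lies in
  the closure, it is the projection of the origin.
\<close>
lemma infimal_displacement_douglas_rachford:
  fixes f g :: "'a::euclidean_space \<Rightarrow> ereal"
  assumes f: "closed_proper_convex f" and g: "closed_proper_convex g" and \<gamma>: "\<gamma> > 0"
    and feas: "primal_feasible f g"
  shows "infimal_displacement_vector (douglas_rachford \<gamma> f g)
    = \<gamma> *\<^sub>R closest_point (closure (dual_domain_sum f g)) 0"
proof -
  define p where "p = closest_point (closure (dual_domain_sum f g)) 0"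
  define S where "S = range (\<lambda>z. z - douglas_rachford \<gamma> f g z)"
  obtain x\<^sub>0 where x0: "x\<^sub>0 \<in> effective_domain f" "x\<^sub>0 \<in> effective_domain g"
    using feas by (auto simp: primal_feasible_def)
  have "\<gamma> *\<^sub>R p \<in> closure S"
    unfolding closure_approachable S_def
    using douglas_rachford_displacement_near_projection[OF f g \<gamma> x0 p_def] by (simp add: dist_norm)
  moreover have "closure S \<subseteq> {s. (norm (\<gamma> *\<^sub>R p))\<^sup>2 \<le> (\<gamma> *\<^sub>R p) \<bullet> s}"
  proof (rule closure_minimal)
    show "S \<subseteq> {s. (norm (\<gamma> *\<^sub>R p))\<^sup>2 \<le> (\<gamma> *\<^sub>R p) \<bullet> s}"
    proof (unfold S_def, intro subsetI CollectI, elim rangeE)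
      fix r z assume r: "r = z - douglas_rachford \<gamma> f g z"
      obtain s where s: "s \<in> dual_domain_sum f g" "z - douglas_rachford \<gamma> f g z = \<gamma> *\<^sub>R s"
        by (rule douglas_rachford_displacement_in_dual_domain_sum[OF f g \<gamma>])
      have "(norm p)\<^sup>2 \<le> p \<bullet> s"
        unfolding p_def by (rule closest_point_origin_obtuse[OF convex_dual_domain_sum s(1)])
      then have "\<gamma>\<^sup>2 * (norm p)\<^sup>2 \<le> \<gamma>\<^sup>2 * (p \<bullet> s)"
        by (rule mult_left_mono) simp
      then show "(norm (\<gamma> *\<^sub>R p))\<^sup>2 \<le> (\<gamma> *\<^sub>R p) \<bullet> r"
        by (simp add: r s(2) power_mult_distrib) (simp add: power2_eq_square mult.assoc)
    qed
    show "closed {s. (norm (\<gamma> *\<^sub>R p))\<^sup>2 \<le> (\<gamma> *\<^sub>R p) \<bullet> s}"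
      by (intro closed_Collect_le continuous_intros)
  qed
  ultimately have "closest_point (closure S) 0 = \<gamma> *\<^sub>R p"
    by (intro closest_point_origin_eqI closed_closure) blast+
  then show ?thesis
    by (simp only: infimal_displacement_vector_def p_def S_def)
qed

text \<open>
  By the obtuse-angle inequality, \<open>- p \<bullet> u \<le> - \<parallel>p\<parallel>\<^sup>2 + p \<bullet> w\<close> for all \<open>u\<close> and \<open>w\<close> in the domains of the two
  conjugates. For a fixed \<open>w\<close> this makes the first support value a real number \<open>\<rho>\<close>, and then letting
  \<open>w\<close> vary bounds the second one by \<open>- \<parallel>p\<parallel>\<^sup>2 - \<rho>\<close>.
\<close>
lemma projection_primal_improving_direction:
  fixes f g :: "'a::euclidean_space \<Rightarrow> ereal"
  assumes f: "closed_proper_convex f" and g: "closed_proper_convex g"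
    and p: "p = closest_point (closure (dual_domain_sum f g)) 0" and "p \<noteq> 0"
  shows "primal_improving_direction f g (- p)"
proof -
  let ?D = "\<lambda>h. effective_domain (convex_conjugate h)"
  let ?\<sigma> = "\<lambda>h. SUP u\<in>?D h. ereal (u \<bullet> - p)"
  have sep: "u \<bullet> - p \<le> - (norm p)\<^sup>2 - w \<bullet> - p" if "u \<in> ?D f" "w \<in> ?D g" for u w
  proof -
    have "u + w \<in> dual_domain_sum f g"
      using that unfolding dual_domain_sum_def by blast
    from closest_point_origin_obtuse[OF convex_dual_domain_sum this]
    have "(norm p)\<^sup>2 \<le> p \<bullet> (u + w)"
      unfolding p .
    then show ?thesis
      by (simp add: inner_add_right inner_commute)
  qed
  obtain u\<^sub>0 w\<^sub>0 where u0: "u\<^sub>0 \<in> ?D f" and w0: "w\<^sub>0 \<in> ?D g"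
    using dual_domain_sum_nonempty[OF f g] by (auto simp: dual_domain_sum_def)
  have upper: "?\<sigma> f \<le> ereal (- (norm p)\<^sup>2 - w \<bullet> - p)" if "w \<in> ?D g" for w
    using sep that by (intro SUP_least) (simp del: inner_minus_right)
  have "ereal (u\<^sub>0 \<bullet> - p) \<le> ?\<sigma> f"
    using u0 by (rule SUP_upper)
  then obtain \<rho> where \<rho>: "?\<sigma> f = ereal \<rho>"
    using upper[OF w0] by (cases "?\<sigma> f") auto
  have "?\<sigma> g \<le> ereal (- (norm p)\<^sup>2 - \<rho>)"
  proof (rule SUP_least)
    fix w assume "w \<in> ?D g"
    from upper[OF this] show "ereal (w \<bullet> - p) \<le> ereal (- (norm p)\<^sup>2 - \<rho>)"
      unfolding \<rho> by simp
  qed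
  then have "?\<sigma> f + ?\<sigma> g \<le> ereal \<rho> + ereal (- (norm p)\<^sup>2 - \<rho>)"
    unfolding \<rho> by (rule add_left_mono)
  also have "\<dots> < 0"
    using \<open>p \<noteq> 0\<close> by simp
  finally show ?thesis
    unfolding primal_improving_direction_def recession_function_eq_support[OF f]
      recession_function_eq_support[OF g] .
qed

theorem corollary3:
  fixes f g :: "real ^ 'n \<Rightarrow> ereal"
    and d :: "real ^ 'n"
  assumes "closed_proper_convex f"
    and "closed_proper_convex g"
    and "primal_feasible f g"
    and "dual_strongly_infeasible f g"
    and "d = - closest_point (closure (dual_domain_sum f g)) 0"
  shows "(\<forall>\<gamma>::real. \<gamma> > 0 \<longrightarrow>
            (\<forall>v. v = - (\<gamma> *\<^sub>R d) \<longrightarrow>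
               v = \<gamma> *\<^sub>R closest_point (closure (dual_domain_sum f g)) 0 \<and>
               v \<noteq> 0 \<and>
               v = infimal_displacement_vector (douglas_rachford \<gamma> f g))) \<and>
         primal_improving_direction f g d"
proof -
  define p where "p = closest_point (closure (dual_domain_sum f g)) 0"
  have "p \<in> closure (dual_domain_sum f g)"
    unfolding p_def using dual_domain_sum_nonempty[OF assms(1,2)]
    by (intro closest_point_in_set) auto
  then have "p \<noteq> 0"
    using assms(4) by (auto simp: dual_strongly_infeasible_def)
  moreover have "d = - p"
    using assms(5) by (simp add: p_def)
  ultimately show ?thesis
    using infimal_displacement_douglas_rachford[OF assms(1,2) _ assms(3)]
      projection_primal_improving_direction[OF assms(1,2) p_def]
    unfolding p_def[symmetric] by simp
qed

end
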